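(* For the compact system $(X,T)$ described in the context (with fixed $0<\lambda<1$), the family $\{Z_m:m\ge0\}$ is a countable $\mathcal E_{\rm orb}$-maximizable family, i.e. $\mathcal E_{\rm orb}(X,T)=\bigcup_{m\ge0}\mathcal E_{Z_m}$.
   Context: The system. For $m\ge1$ set $p_m=m+1$, $a_m=2^{-m}$, $Q_m=\{(m,j):j\in\mathbb Z/p_m\mathbb Z\}$; $Q_0=\{\ast\}$; $Y=\{\ast\}\sqcup\bigsqcup_{m\ge1}Q_m$. Put $r(\ast)=0$, $r(m,j)=a_m$, and $d_Y(u,v)=0$ if $u=v$, $d_Y(u,v)=r(u)+r(v)$ if $u\ne v$. $R:Y\to Y$, $R(\ast)=\ast$, $R(m,j)=(m,j+1 \bmod p_m)$. Fix $0<\lambda<1$; $X=Y\times[0,1]$, $d_X((u,t),(v,s))=d_Y(u,v)+|t-s|$, $T(u,t)=(Ru,\lambda t)$. $Z_m=Q_m\times\{0\}$ for $m\ge0$. The space. $S_ng=\sum_{j=0}^{n-1}g\circ T^j$. $\mathcal A(X,T)$: sequences $\Psi=\{\psi_n\}_{n\ge1}\subset C(X,\mathbb R)$ such that for every $\xi>0$ there is $g\in C(X,\mathbb R)$ with $\limsup_n\frac1n\|\psi_n-S_ng\|_\infty\le\xi$. $D(\Psi)=\sup_{n,k\ge1}\|\psi_{n+k}-\psi_n-\psi_k\circ T^n\|_\infty$, $L_{\rm orb}(\Psi)=\sup_{n\ge1,x\ne y}|\psi_n(x)-\psi_n(y)|/\sum_{j=0}^{n-1}d_X(T^jx,T^jy)$.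 $\mathcal{AA}_{\rm orb}(X,T)=\{\Psi\in\mathcal A(X,T):D(\Psi),L_{\rm orb}(\Psi)<\infty\}$; $\mathcal N=\{\Psi\in\mathcal A(X,T):\lim_n\frac1n\|\psi_n\|_\infty=0\}$; $\mathcal E_{\rm orb}(X,T)=\mathcal{AA}_{\rm orb}(X,T)/(\mathcal{AA}_{\rm orb}(X,T)\cap\mathcal N)$. $\mathcal M(X,T)$: $T$-invariant Borel probability measures; $\mathcal M(Z,T)$ those supported on the closed invariant set $Z$. For $\eta=[\Phi]$, $\eta_*(\mu)=\lim_n\frac1n\int\phi_n\,d\mu$ (well defined), $\mathcal M_{\max}(\eta)=\{\mu\in\mathcal M(X,T):\eta_*(\mu)=\max_\nu\eta_*(\nu)\}$, $\mathcal E_Z=\{\eta\in\mathcal E_{\rm orb}(X,T):\mathcal M_{\max}(\eta)\cap\mathcal M(Z,T)\ne\varnothing\}$. *)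

theory Defs
  imports "HOL-Analysis.Analysis" "HOL-Probability.Probability"
begin

section \<open>Asymptotically additive sequences and ergodic optimization\<close>

text \<open>
  The ambient space is the whole type, intended to be a compact metric space, and
  \<open>T\<close> is the dynamics. A sequence indexed by \<open>n \<ge> 1\<close> is encoded as a function on all
  of \<^typ>\<open>nat\<close> whose entry at \<open>0\<close> is fixed to be the zero function (see
  \<open>asymp_additive\<close>); this loses and adds nothing.
\<close>

definition birkhoff_sum :: "('a \<Rightarrow> 'a) \<Rightarrow> nat \<Rightarrow> ('a \<Rightarrow> real) \<Rightarrow> 'a \<Rightarrow> real" where
  "birkhoff_sum T n g x = (\<Sum>j<n. g ((T ^^ j) x))"

definition sup_norm :: "('a \<Rightarrow> real) \<Rightarrow> ennreal" where
  "sup_norm f = (SUP x. ennreal \<bar>f x\<bar>)"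

definition asymp_additive :: "('a::metric_space \<Rightarrow> 'a) \<Rightarrow> (nat \<Rightarrow> 'a \<Rightarrow> real) set" where
  "asymp_additive T = {\<psi>.
     \<psi> 0 = (\<lambda>x. 0) \<and>
     (\<forall>n\<ge>1. continuous_on UNIV (\<psi> n)) \<and>
     (\<forall>\<xi>>0. \<exists>g. continuous_on UNIV g \<and>
        limsup (\<lambda>n. sup_norm (\<lambda>x. \<psi> n x - birkhoff_sum T n g x) / of_nat n) \<le> ennreal \<xi>)}"

definition almost_additive_defect :: "('a \<Rightarrow> 'a) \<Rightarrow> (nat \<Rightarrow> 'a \<Rightarrow> real) \<Rightarrow> ennreal" where
  "almost_additive_defect T \<psi> =
     (SUP (n, k) \<in> {1..} \<times> {1..}.
        sup_norm (\<lambda>x. \<psi> (n + k) x - \<psi> n x - \<psi> k ((T ^^ n) x)))"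

definition orbit_lipschitz :: "('a::metric_space \<Rightarrow> 'a) \<Rightarrow> (nat \<Rightarrow> 'a \<Rightarrow> real) \<Rightarrow> ennreal" where
  "orbit_lipschitz T \<psi> =
     (SUP (n, x, y) \<in> {(n, x, y). 1 \<le> n \<and> x \<noteq> y}.
        ennreal (\<bar>\<psi> n x - \<psi> n y\<bar> / (\<Sum>j<n. dist ((T ^^ j) x) ((T ^^ j) y))))"

definition AA_orb :: "('a::metric_space \<Rightarrow> 'a) \<Rightarrow> (nat \<Rightarrow> 'a \<Rightarrow> real) set" where
  "AA_orb T = {\<psi> \<in> asymp_additive T.
     almost_additive_defect T \<psi> < \<infinity> \<and> orbit_lipschitz T \<psi> < \<infinity>}"

definition null_seqs :: "('a::metric_space \<Rightarrow> 'a) \<Rightarrow> (nat \<Rightarrow> 'a \<Rightarrow> real) set" where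
  "null_seqs T = {\<psi> \<in> asymp_additive T. (\<lambda>n. sup_norm (\<psi> n) / of_nat n) \<longlonglongrightarrow> 0}"

definition orb_equiv ::
  "('a::metric_space \<Rightarrow> 'a) \<Rightarrow> ((nat \<Rightarrow> 'a \<Rightarrow> real) \<times> (nat \<Rightarrow> 'a \<Rightarrow> real)) set" where
  "orb_equiv T = {(\<phi>, \<psi>). \<phi> \<in> AA_orb T \<and> \<psi> \<in> AA_orb T \<and>
     (\<lambda>n x. \<phi> n x - \<psi> n x) \<in> AA_orb T \<inter> null_seqs T}"

definition E_orb :: "('a::metric_space \<Rightarrow> 'a) \<Rightarrow> (nat \<Rightarrow> 'a \<Rightarrow> real) set set" where
  "E_orb T = AA_orb T // orb_equiv T"

definition inv_measures :: "('a::metric_space \<Rightarrow> 'a) \<Rightarrow> 'a measure set" where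
  "inv_measures T = {\<mu>. prob_space \<mu> \<and> sets \<mu> = sets borel \<and>
     (\<forall>A \<in> sets borel. emeasure \<mu> (T -` A) = emeasure \<mu> A)}"

definition inv_measures_on :: "('a::metric_space \<Rightarrow> 'a) \<Rightarrow> 'a set \<Rightarrow> 'a measure set" where
  "inv_measures_on T Z = {\<mu> \<in> inv_measures T. emeasure \<mu> (- Z) = 0}"

text \<open>The common value of the limit over all representatives of the class.\<close>

definition eval_class :: "(nat \<Rightarrow> 'a \<Rightarrow> real) set \<Rightarrow> 'a measure \<Rightarrow> real" where
  "eval_class \<eta> \<mu> =
     (THE c. \<forall>\<phi>\<in>\<eta>. (\<lambda>n. (\<integral>x. \<phi> n x \<partial>\<mu>) / real n) \<longlonglongrightarrow> c)"

definition max_measures ::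
  "('a::metric_space \<Rightarrow> 'a) \<Rightarrow> (nat \<Rightarrow> 'a \<Rightarrow> real) set \<Rightarrow> 'a measure set" where
  "max_measures T \<eta> = {\<mu> \<in> inv_measures T.
     \<forall>\<nu> \<in> inv_measures T. eval_class \<eta> \<nu> \<le> eval_class \<eta> \<mu>}"

definition E_max_on ::
  "('a::metric_space \<Rightarrow> 'a) \<Rightarrow> 'a set \<Rightarrow> (nat \<Rightarrow> 'a \<Rightarrow> real) set set" where
  "E_max_on T Z = {\<eta> \<in> E_orb T. max_measures T \<eta> \<inter> inv_measures_on T Z \<noteq> {}}"

definition E_orb_maximizable :: "('a::metric_space \<Rightarrow> 'a) \<Rightarrow> 'a set set \<Rightarrow> bool" where
  "E_orb_maximizable T \<Z> \<longleftrightarrow>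
     (\<forall>Z\<in>\<Z>. closed Z \<and> T ` Z \<subseteq> Z) \<and> E_orb T = (\<Union>Z\<in>\<Z>. E_max_on T Z)"


section \<open>The base space of cycles accumulating at a fixed point\<close>

definition period :: "nat \<Rightarrow> nat" where "period m = m + 1"

definition rad :: "nat \<Rightarrow> real" where "rad m = 1 / 2 ^ m"

text \<open>\<^term>\<open>None\<close> is the point \<open>\<ast>\<close>; residues modulo \<open>period m\<close> are represented in \<open>{0..<period m}\<close>.\<close>

typedef Y_space = "insert None {Some (m, j) | m j. 1 \<le> m \<and> j < period m}"
  by blast

definition star :: Y_space where "star = Abs_Y_space None"

definition cyc :: "nat \<Rightarrow> nat \<Rightarrow> Y_space" where "cyc m j = Abs_Y_space (Some (m, j))"

definition radius :: "Y_space \<Rightarrow> real" where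
  "radius u = (case Rep_Y_space u of None \<Rightarrow> 0 | Some (m, j) \<Rightarrow> rad m)"

definition rotate_cycles :: "Y_space \<Rightarrow> Y_space" where
  "rotate_cycles u = (case Rep_Y_space u of None \<Rightarrow> star | Some (m, j) \<Rightarrow>
     cyc m ((j + 1) mod period m))"

definition Q_set :: "nat \<Rightarrow> Y_space set" where
  "Q_set m = (if m = 0 then {star} else cyc m ` {0..<period m})"

lemma radius_nonneg: "radius u \<ge> 0"
  by (auto simp: radius_def rad_def split: option.splits)

lemma radius_eq_0_iff: "radius u = 0 \<longleftrightarrow> u = star"
  using Rep_Y_space[of u]
  by (auto simp: radius_def rad_def star_def Abs_Y_space_inverse Rep_Y_space_inverse
      Rep_Y_space_inject[symmetric] split: option.splits)

instantiation Y_space :: metric_space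
begin

definition dist_Y_space :: "Y_space \<Rightarrow> Y_space \<Rightarrow> real" where
  "dist_Y_space u v = (if u = v then 0 else radius u + radius v)"

definition uniformity_Y_space :: "(Y_space \<times> Y_space) filter" where
  "uniformity_Y_space = (INF e\<in>{0<..}. principal {(x, y). dist x y < e})"

definition open_Y_space :: "Y_space set \<Rightarrow> bool" where
  "open_Y_space U \<longleftrightarrow> (\<forall>x\<in>U. \<forall>\<^sub>F (x', y) in uniformity. x' = x \<longrightarrow> y \<in> U)"

instance
proof
  fix x y z :: Y_space
  show "dist x y = 0 \<longleftrightarrow> x = y"
    using radius_nonneg[of x] radius_nonneg[of y] radius_eq_0_iff[of x] radius_eq_0_iff[of y]
    by (auto simp: dist_Y_space_def add_nonneg_eq_0_iff)
  show "dist x y \<le> dist x z + dist y z"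
    using radius_nonneg[of x] radius_nonneg[of y] radius_nonneg[of z] by (auto simp: dist_Y_space_def)
qed (simp_all add: uniformity_Y_space_def open_Y_space_def)

end


section \<open>The system\<close>

text \<open>
  A separate type is used because the library's metric on product types is the
  Euclidean one, whereas here the metric is the sum of the two component metrics.
\<close>

typedef X_space = "(UNIV :: Y_space set) \<times> {0..1::real}"
  by auto

definition base :: "X_space \<Rightarrow> Y_space" where "base x = fst (Rep_X_space x)"

definition height :: "X_space \<Rightarrow> real" where "height x = snd (Rep_X_space x)"

instantiation X_space :: metric_space
begin

definition dist_X_space :: "X_space \<Rightarrow> X_space \<Rightarrow> real" where
  "dist_X_space x y = dist (base x) (base y) + \<bar>height x - height y\<bar>"

definition uniformity_X_space :: "(X_space \<times> X_space) filter" where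
  "uniformity_X_space = (INF e\<in>{0<..}. principal {(x, y). dist x y < e})"

definition open_X_space :: "X_space set \<Rightarrow> bool" where
  "open_X_space U \<longleftrightarrow> (\<forall>x\<in>U. \<forall>\<^sub>F (x', y) in uniformity. x' = x \<longrightarrow> y \<in> U)"

instance
proof
  fix x y z :: X_space
  show "dist x y = 0 \<longleftrightarrow> x = y"
    by (auto simp: dist_X_space_def add_nonneg_eq_0_iff base_def height_def
        prod_eq_iff Rep_X_space_inject[symmetric])
  show "dist x y \<le> dist x z + dist y z"
    using dist_triangle2[of "base x" "base y" "base z"] by (simp add: dist_X_space_def)
qed (simp_all add: uniformity_X_space_def open_X_space_def)

end

text \<open>For \<open>0 \<le> lam \<le> 1\<close> the argument of \<^const>\<open>Abs_X_space\<close> lies in the carrier.\<close>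

definition sys_map :: "real \<Rightarrow> X_space \<Rightarrow> X_space" where
  "sys_map lam x = Abs_X_space (rotate_cycles (base x), lam * height x)"

definition Z_set :: "nat \<Rightarrow> X_space set" where
  "Z_set m = {x. base x \<in> Q_set m \<and> height x = 0}"

end

theory Submission
  imports Defs
begin

text \<open>
  Asymptotic additivity makes \<open>\<psi>\<^sub>n / n\<close> converge at the periodic points \<open>(u, 0)\<close>. Fibres contract
  geometrically, so by the orbit Lipschitz bound \<open>\<psi>\<^sub>n / n\<close> has the same limit at \<open>(u, t)\<close>. By dominated convergence a class
  is therefore evaluated at a measure by integrating one bounded, orbitwise constant function \<open>C\<close>.
  The same bound gives \<open>\<bar>C (u, 0) - C (\<ast>, 0)\<bar> \<le> L \<cdot> r u\<close>, and \<open>r\<close> exceeds any positive threshold only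
  finitely often, so \<open>C\<close> attains its maximum at a periodic point; the measure equidistributed on the
  orbit of that point is maximizing.
\<close>

section \<open>Asymptotically additive sequences along periodic orbits\<close>

lemma abs_le_sup_norm: "ennreal \<bar>f x\<bar> \<le> sup_norm f"
  unfolding sup_norm_def by (rule SUP_upper) simp

text \<open>Carries the \<open>ennreal\<close>-valued norms of the definitions over to real averages
  at a single point, where the whole argument takes place.\<close>

lemma abs_div_less_of_sup_norm:
  assumes "sup_norm f / of_nat n < ennreal e" and "n > 0"
  shows "\<bar>f x\<bar> / real n < e"
proof -
  have "ennreal (\<bar>f x\<bar> / real n) = ennreal \<bar>f x\<bar> / of_nat n"
    using assms(2) by (simp add: divide_ennreal ennreal_of_nat_eq_real_of_nat)
  also have "\<dots> \<le> sup_norm f / of_nat n"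
    by (intro divide_right_mono_ennreal abs_le_sup_norm)
  also have "\<dots> < ennreal e" by fact
  finally show ?thesis by (simp add: ennreal_less_iff)
qed

lemma null_seqs_pointwise:
  assumes "\<psi> \<in> null_seqs T"
  shows "(\<lambda>n. \<psi> n x / real n) \<longlonglongrightarrow> 0"
proof (rule LIMSEQ_I)
  fix r :: real assume "r > 0"
  have "(\<lambda>n. sup_norm (\<psi> n) / of_nat n) \<longlonglongrightarrow> 0"
    using assms by (simp add: null_seqs_def)
  from order_tendstoD(2)[OF this, of "ennreal r"] \<open>r > 0\<close>
  have "\<forall>\<^sub>F n in sequentially. sup_norm (\<psi> n) / of_nat n < ennreal r" by simp
  with eventually_gt_at_top[of 0]
  have "\<forall>\<^sub>F n in sequentially. \<bar>\<psi> n x\<bar> / real n < r"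
    by eventually_elim (rule abs_div_less_of_sup_norm)
  then show "\<exists>no. \<forall>n\<ge>no. norm (\<psi> n x / real n - 0) < r"
    by (simp add: eventually_sequentially)
qed

lemma asymp_additive_pointwise:
  assumes "\<psi> \<in> asymp_additive T" and "e > 0"
  obtains g where "\<forall>\<^sub>F n in sequentially. \<bar>\<psi> n x / real n - birkhoff_sum T n g x / real n\<bar> < e"
proof -
  \<comment> \<open>The definition bounds a limsup only weakly; halving \<open>e\<close> leaves the
    strict gap from which an eventual bound follows.\<close>
  from assms have "e / 2 > 0" by simp
  with assms(1) obtain g where
    g: "limsup (\<lambda>n. sup_norm (\<lambda>x. \<psi> n x - birkhoff_sum T n g x) / of_nat n) \<le> ennreal (e / 2)"
    unfolding asymp_additive_def by blast
  also have "ennreal (e / 2) < ennreal e" using assms(2) by (simp add: ennreal_less_iff)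
  finally have "\<forall>\<^sub>F n in sequentially.
      sup_norm (\<lambda>x. \<psi> n x - birkhoff_sum T n g x) / of_nat n < ennreal e"
    by (rule Limsup_lessD)
  with eventually_gt_at_top[of 0]
  have "\<forall>\<^sub>F n in sequentially. \<bar>\<psi> n x / real n - birkhoff_sum T n g x / real n\<bar> < e"
  proof eventually_elim
    case (elim n)
    from abs_div_less_of_sup_norm[OF elim(2,1), of x] show ?case
      by (simp add: diff_divide_distrib[symmetric])
  qed
  then show ?thesis by (rule that)
qed

text \<open>The averages differ by at most \<open>K / n\<close>. This absorbs every bounded error
  below: periodic remainders, the additivity defect and the contraction along fibres.\<close>

lemma tendsto_average_bounded_diff:
  fixes a b :: "nat \<Rightarrow> real"
  assumes lim: "(\<lambda>n. a n / real n) \<longlonglongrightarrow> c" and bd: "\<And>n. n \<ge> 1 \<Longrightarrow> \<bar>a n - b n\<bar> \<le> K"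
  shows "(\<lambda>n. b n / real n) \<longlonglongrightarrow> c"
proof -
  have "(\<lambda>n. a n / real n - b n / real n) \<longlonglongrightarrow> 0"
  proof (rule Lim_null_comparison)
    show "\<forall>\<^sub>F n in sequentially. norm (a n / real n - b n / real n) \<le> K * (1 / real n)"
      using eventually_ge_at_top[of 1]
      by eventually_elim
        (use bd in \<open>simp add: diff_divide_distrib[symmetric] divide_right_mono\<close>)
    show "(\<lambda>n. K * (1 / real n)) \<longlonglongrightarrow> 0"
      using tendsto_mult[OF tendsto_const lim_1_over_n, of K] by simp
  qed
  from tendsto_diff[OF lim this] show ?thesis by simp
qed

text \<open>With \<open>A\<close> the mean over \<open>p\<close> steps, the remainder
  \<open>h\<close> left after removing the linear term \<open>n * A\<close> is
  \<open>p\<close>-periodic in \<open>n\<close>, hence bounded.\<close>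

lemma birkhoff_average_periodic:
  assumes per: "(T ^^ p) x = x" and p: "p > 0"
  shows "(\<lambda>n. birkhoff_sum T n g x / real n) \<longlonglongrightarrow> birkhoff_sum T p g x / real p"
proof -
  define A where "A = birkhoff_sum T p g x / real p"
  define h where "h n = birkhoff_sum T n g x - real n * A" for n
  have step: "h (n + p) = h n" for n
  proof -
    have "birkhoff_sum T (n + p) g x = birkhoff_sum T p g x + birkhoff_sum T n g x"
      by (induction n) (simp_all add: birkhoff_sum_def funpow_add per)
    then show ?thesis using p by (simp add: h_def A_def field_simps)
  qed
  have h_mod: "h n = h (n mod p)" for n
  proof (induction n rule: less_induct)
    case (less n)
    show ?case
    proof (cases "n < p")
      case False
      with less[of "n - p"] step[of "n - p"] p show ?thesis by (simp add: mod_if)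
    qed simp
  qed
  have h_bound: "\<bar>h n\<bar> \<le> (\<Sum>i<p. \<bar>h i\<bar>)" for n
    using p by (subst h_mod) (rule member_le_sum, auto)
  \<comment> \<open>Only eventually, since division by zero makes the right side 0 at
    \<open>n = 0\<close>.\<close>
  have "\<forall>\<^sub>F n in sequentially. A = real n * A / real n"
    using eventually_gt_at_top[of 0] by eventually_elim simp
  then have "(\<lambda>n. real n * A / real n) \<longlonglongrightarrow> A"
    by (rule Lim_transform_eventually[OF tendsto_const])
  then show ?thesis unfolding A_def[symmetric]
    by (rule tendsto_average_bounded_diff[where K = "\<Sum>i<p. \<bar>h i\<bar>"])
      (use h_bound in \<open>simp add: h_def abs_minus_commute\<close>)
qed

text \<open>The approximant \<open>b\<close> may change with \<open>e\<close>, so there is no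
  candidate limit at hand; an \<open>e / 3\<close> argument gives the Cauchy property
  instead.\<close>

lemma Cauchy_if_approx_convergent:
  fixes a :: "nat \<Rightarrow> real"
  assumes "\<And>e. e > 0 \<Longrightarrow> \<exists>b. convergent b \<and> (\<forall>\<^sub>F n in sequentially. \<bar>a n - b n\<bar> < e)"
  shows "Cauchy a"
proof (rule CauchyI)
  fix e :: real assume "e > 0"
  then obtain b where b: "convergent b" "\<forall>\<^sub>F n in sequentially. \<bar>a n - b n\<bar> < e / 3"
    using assms[of "e / 3"] by auto
  obtain M where M: "\<And>n. n \<ge> M \<Longrightarrow> \<bar>a n - b n\<bar> < e / 3"
    using b(2) by (auto simp: eventually_sequentially)
  obtain K where K: "\<And>m n. m \<ge> K \<Longrightarrow> n \<ge> K \<Longrightarrow> norm (b m - b n) < e / 3"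
    using CauchyD[OF convergent_Cauchy[OF b(1)], of "e / 3"] \<open>e > 0\<close> by auto
  have "norm (a m - a n) < e" if "m \<ge> max M K" "n \<ge> max M K" for m n
  proof -
    from that have "\<bar>a m - b m\<bar> < e / 3" "\<bar>a n - b n\<bar> < e / 3" "\<bar>b m - b n\<bar> < e / 3"
      using M[of m] M[of n] K[of m n] by auto
    then show ?thesis unfolding real_norm_def by arith
  qed
  then show "\<exists>M. \<forall>m\<ge>M. \<forall>n\<ge>M. norm (a m - a n) < e" by blast
qed

lemma asymp_additive_periodic_convergent:
  assumes "\<psi> \<in> asymp_additive T" and "(T ^^ p) x = x" and "p > 0"
  shows "convergent (\<lambda>n. \<psi> n x / real n)"
proof -
  have "Cauchy (\<lambda>n. \<psi> n x / real n)"
  proof (rule Cauchy_if_approx_convergent)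
    fix e :: real assume "e > 0"
    with assms(1) obtain g where
      "\<forall>\<^sub>F n in sequentially. \<bar>\<psi> n x / real n - birkhoff_sum T n g x / real n\<bar> < e"
      by (rule asymp_additive_pointwise)
    with birkhoff_average_periodic[OF assms(2,3), of g]
    show "\<exists>b. convergent b \<and> (\<forall>\<^sub>F n in sequentially. \<bar>\<psi> n x / real n - b n\<bar> < e)"
      by (auto simp: convergent_def)
  qed
  then show ?thesis by (rule Cauchy_convergent)
qed

section \<open>Almost additivity and orbit Lipschitz bounds\<close>

lemma orbit_lipschitzD:
  fixes T :: "'a::metric_space \<Rightarrow> 'a"
  assumes "orbit_lipschitz T \<psi> < \<infinity>"
  obtains L where "L \<ge> 0"
    and "\<And>n x y. n \<ge> 1 \<Longrightarrow> \<bar>\<psi> n x - \<psi> n y\<bar> \<le> L * (\<Sum>j<n. dist ((T ^^ j) x) ((T ^^ j) y))"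
proof
  define L where "L = enn2real (orbit_lipschitz T \<psi>)"
  show "L \<ge> 0" by (simp add: L_def)
  fix n :: nat and x y :: 'a assume n: "n \<ge> 1"
  let ?S = "\<Sum>j<n. dist ((T ^^ j) x) ((T ^^ j) y)"
  show "\<bar>\<psi> n x - \<psi> n y\<bar> \<le> L * ?S"
  proof (cases "x = y")
    case False
    have "ennreal (\<bar>\<psi> n x - \<psi> n y\<bar> / ?S) \<le> orbit_lipschitz T \<psi>"
      unfolding orbit_lipschitz_def
      by (rule SUP_upper2[of "(n, x, y)"]) (use n False in auto)
    also have "\<dots> = ennreal L"
      using assms by (simp add: L_def ennreal_enn2real_if)
    finally have le: "\<bar>\<psi> n x - \<psi> n y\<bar> / ?S \<le> L"
      using \<open>L \<ge> 0\<close> by (simp add: ennreal_le_iff)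
    \<comment> \<open>The summand at \<open>j = 0\<close> keeps the denominator positive even if the
      two orbits merge later.\<close>
    have "0 < dist ((T ^^ 0) x) ((T ^^ 0) y)" using False by simp
    also have "\<dots> \<le> ?S"
      using n by (intro member_le_sum) auto
    finally have "?S > 0" .
    with le show ?thesis by (simp add: pos_divide_le_eq)
  qed simp
qed

lemma almost_additive_defectD:
  assumes "almost_additive_defect T \<psi> < \<infinity>"
  obtains D where
    "\<And>n k x. n \<ge> 1 \<Longrightarrow> k \<ge> 1 \<Longrightarrow> \<bar>\<psi> (n + k) x - \<psi> n x - \<psi> k ((T ^^ n) x)\<bar> \<le> D"
proof
  fix n k :: nat and x assume nk: "n \<ge> 1" "k \<ge> 1"
  have "ennreal \<bar>\<psi> (n + k) x - \<psi> n x - \<psi> k ((T ^^ n) x)\<bar>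
      \<le> sup_norm (\<lambda>x. \<psi> (n + k) x - \<psi> n x - \<psi> k ((T ^^ n) x))"
    by (rule abs_le_sup_norm)
  also have "\<dots> \<le> almost_additive_defect T \<psi>"
    unfolding almost_additive_defect_def
    by (rule SUP_upper2[of "(n, k)"]) (use nk in auto)
  also have "\<dots> = ennreal (enn2real (almost_additive_defect T \<psi>))"
    using assms by (simp add: ennreal_enn2real_if)
  finally show "\<bar>\<psi> (n + k) x - \<psi> n x - \<psi> k ((T ^^ n) x)\<bar>
      \<le> enn2real (almost_additive_defect T \<psi>)"
    by (simp add: ennreal_le_iff)
qed

text \<open>A single step, the defect bound at \<open>n = 1\<close>, compares
  \<open>\<psi> (Suc n) x\<close> with \<open>\<psi> n (T x)\<close> up to a constant. Iterated, it
  makes the limit constant along orbits.\<close>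

lemma limit_average_shift:
  assumes "almost_additive_defect T \<psi> < \<infinity>" and lim: "(\<lambda>n. \<psi> n x / real n) \<longlonglongrightarrow> c"
  shows "(\<lambda>n. \<psi> n (T x) / real n) \<longlonglongrightarrow> c"
proof -
  obtain D where
    D: "\<And>n k x. n \<ge> 1 \<Longrightarrow> k \<ge> 1 \<Longrightarrow> \<bar>\<psi> (n + k) x - \<psi> n x - \<psi> k ((T ^^ n) x)\<bar> \<le> D"
    using assms(1) by (rule almost_additive_defectD) blast
  have "(\<lambda>n. \<psi> (Suc n) x / real (Suc n)) \<longlonglongrightarrow> c"
    using lim by (rule LIMSEQ_Suc)
  \<comment> \<open>Renormalizes from \<open>Suc n\<close> to \<open>n\<close>.\<close>
  then have "(\<lambda>n. \<psi> (Suc n) x / real (Suc n) * (real (Suc n) / real n)) \<longlonglongrightarrow> c * 1"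
    using LIMSEQ_Suc_n_over_n by (rule tendsto_mult)
  then have "(\<lambda>n. \<psi> (Suc n) x / real n) \<longlonglongrightarrow> c" by simp
  then show ?thesis
  proof (rule tendsto_average_bounded_diff)
    fix n :: nat assume "n \<ge> 1"
    with D[of 1 n x] show "\<bar>\<psi> (Suc n) x - \<psi> n (T x)\<bar> \<le> D + \<bar>\<psi> 1 x\<bar>" by simp
  qed
qed

lemma limit_average_orbit:
  assumes "almost_additive_defect T \<psi> < \<infinity>" and "(\<lambda>n. \<psi> n x / real n) \<longlonglongrightarrow> c"
  shows "(\<lambda>n. \<psi> n ((T ^^ j) x) / real n) \<longlonglongrightarrow> c"
  using assms by (induction j) (auto intro: limit_average_shift)

text \<open>Supplies reflexivity of \<open>orb_equiv\<close>, so that a class contains the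
  representative generating it.\<close>

lemma zero_in_AA_orb_null: "(\<lambda>n x. 0) \<in> AA_orb T \<inter> null_seqs T"
proof -
  have zero: "sup_norm (\<lambda>x. 0 :: real) = 0" by (simp add: sup_norm_def)
  have "continuous_on UNIV (\<lambda>x. 0 :: real) \<and>
      limsup (\<lambda>n. sup_norm (\<lambda>x. 0 - birkhoff_sum T n (\<lambda>x. 0) x) / of_nat n) \<le> ennreal \<xi>"
    for \<xi> by (simp add: birkhoff_sum_def zero Limsup_const)
  then have "(\<lambda>n x. 0) \<in> asymp_additive T" unfolding asymp_additive_def by blast
  moreover have "almost_additive_defect T (\<lambda>n x. 0) \<le> 0"
    unfolding almost_additive_defect_def by (intro SUP_least) (auto simp: zero)
  moreover have "orbit_lipschitz T (\<lambda>n x. 0) \<le> 0"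
    unfolding orbit_lipschitz_def by (intro SUP_least) auto
  ultimately show ?thesis by (simp add: AA_orb_def null_seqs_def zero)
qed

lemma E_orb_cases:
  assumes "\<eta> \<in> E_orb T"
  obtains \<phi> where "\<phi> \<in> AA_orb T" "\<phi> \<in> \<eta>"
    "\<And>\<psi>. \<psi> \<in> \<eta> \<Longrightarrow> \<psi> \<in> AA_orb T \<and> (\<lambda>n x. \<phi> n x - \<psi> n x) \<in> null_seqs T"
proof -
  from assms obtain \<phi> where "\<phi> \<in> AA_orb T" "\<eta> = orb_equiv T `` {\<phi>}"
    unfolding E_orb_def by (auto elim: quotientE)
  with zero_in_AA_orb_null[of T] show ?thesis
    by (intro that[of \<phi>]) (auto simp: orb_equiv_def)
qed

section \<open>Evaluation of a class by its pointwise limit\<close>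

text \<open>Over \<open>n\<close> steps the orbit distances sum to at most \<open>n * d\<close>, so
  an average at any point is within \<open>L * d\<close> of the one at \<open>z\<close>, and a
  convergent sequence is bounded. The resulting \<open>B\<close> is the dominating constant for the
  integrals.\<close>

lemma AA_orb_averages_bounded:
  fixes T :: "'a::metric_space \<Rightarrow> 'a"
  assumes "\<psi> \<in> AA_orb T" and diam: "\<And>x y :: 'a. dist x y \<le> d"
    and conv: "convergent (\<lambda>n. \<psi> n z / real n)"
  obtains B where "\<And>n x. \<bar>\<psi> n x / real n\<bar> \<le> B"
proof -
  obtain L where "L \<ge> 0" and
    L: "\<And>n x y. n \<ge> 1 \<Longrightarrow> \<bar>\<psi> n x - \<psi> n y\<bar> \<le> L * (\<Sum>j<n. dist ((T ^^ j) x) ((T ^^ j) y))"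
    using assms(1) orbit_lipschitzD[of T \<psi>] by (auto simp: AA_orb_def)
  from conv have "Bseq (\<lambda>n. \<psi> n z / real n)" by (rule convergent_imp_Bseq)
  then obtain K where K: "K > 0" "\<And>n. norm (\<psi> n z / real n) \<le> K" by (auto simp: Bseq_def)
  have "d \<ge> 0" using diam[of z z] by simp
  have "\<bar>\<psi> n x / real n\<bar> \<le> L * d + K" for n x
  proof (cases "n = 0")
    case False
    have "\<bar>\<psi> n x - \<psi> n z\<bar> \<le> L * (\<Sum>j<n. d)"
      using False by (intro order_trans[OF L] mult_left_mono sum_mono diam \<open>L \<ge> 0\<close>) auto
    then have "\<bar>\<psi> n x / real n - \<psi> n z / real n\<bar> \<le> L * d"
      using False by (simp add: diff_divide_distrib[symmetric] pos_divide_le_eq mult_ac)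
    with K(2)[of n] show ?thesis unfolding real_norm_def by arith
  qed (use \<open>L \<ge> 0\<close> \<open>d \<ge> 0\<close> K in simp)
  then show ?thesis by (rule that)
qed

lemma tendsto_integral_averages:
  fixes T :: "'a::metric_space \<Rightarrow> 'a"
  assumes \<psi>: "\<psi> \<in> AA_orb T" and diam: "\<And>x y :: 'a. dist x y \<le> d"
    and lim: "\<And>x. (\<lambda>n. \<psi> n x / real n) \<longlonglongrightarrow> C x"
    and \<mu>: "prob_space \<mu>" "sets \<mu> = sets borel"
  shows "integrable \<mu> C" and "(\<lambda>n. (\<integral>x. \<psi> n x \<partial>\<mu>) / real n) \<longlonglongrightarrow> (\<integral>x. C x \<partial>\<mu>)"
proof -
  interpret prob_space \<mu> by fact
  obtain B where B: "\<And>n x. \<bar>\<psi> n x / real n\<bar> \<le> B"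
    by (rule AA_orb_averages_bounded[OF \<psi> diam]) (use lim in \<open>auto simp: convergent_def\<close>)
  have meas: "(\<lambda>x. \<psi> n x / real n) \<in> borel_measurable \<mu>" for n
  \<comment> \<open>Continuity is required for \<open>n \<ge> 1\<close> only; at 0 the quotient is
    the zero function.\<close>
  proof (cases "n = 0")
    case False
    with \<psi> have "continuous_on UNIV (\<psi> n)" by (auto simp: AA_orb_def asymp_additive_def)
    then have "\<psi> n \<in> borel_measurable \<mu>"
      unfolding measurable_cong_sets[OF \<mu>(2) refl] by (rule borel_measurable_continuous_onI)
    then show ?thesis by simp
  qed simp
  have C: "C \<in> borel_measurable \<mu>"
    by (rule borel_measurable_LIMSEQ_real[OF lim meas])
  note dom = C meas integrable_const AE_I2[OF lim] AE_I2[of \<mu>, OF B[folded real_norm_def]]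
  show "integrable \<mu> C"
    by (rule integrable_dominated_convergence[OF dom])
  have "(\<lambda>n. \<integral>x. \<psi> n x / real n \<partial>\<mu>) \<longlonglongrightarrow> (\<integral>x. C x \<partial>\<mu>)"
    by (rule integral_dominated_convergence[OF dom])
  then show "(\<lambda>n. (\<integral>x. \<psi> n x \<partial>\<mu>) / real n) \<longlonglongrightarrow> (\<integral>x. C x \<partial>\<mu>)" by simp
qed

text \<open>All representatives share the pointwise limit \<open>C\<close>, as they differ from
  \<phi> by null sequences. Since \<eta> is nonempty, at most one number can satisfy the definite
  description.\<close>

lemma eval_class_eq_integral:
  fixes T :: "'a::metric_space \<Rightarrow> 'a"
  assumes "\<phi> \<in> \<eta>"
    and \<eta>: "\<And>\<psi>. \<psi> \<in> \<eta> \<Longrightarrow> \<psi> \<in> AA_orb T \<and> (\<lambda>n x. \<phi> n x - \<psi> n x) \<in> null_seqs T"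
    and diam: "\<And>x y :: 'a. dist x y \<le> d"
    and lim: "\<And>x. (\<lambda>n. \<phi> n x / real n) \<longlonglongrightarrow> C x"
    and \<mu>: "prob_space \<mu>" "sets \<mu> = sets borel"
  shows "eval_class \<eta> \<mu> = (\<integral>x. C x \<partial>\<mu>)"
  unfolding eval_class_def
proof (rule the_equality)
  show "\<forall>\<psi>\<in>\<eta>. (\<lambda>n. (\<integral>x. \<psi> n x \<partial>\<mu>) / real n) \<longlonglongrightarrow> (\<integral>x. C x \<partial>\<mu>)"
  proof
    fix \<psi> assume "\<psi> \<in> \<eta>"
    note \<psi> = \<eta>[OF this]
    show "(\<lambda>n. (\<integral>x. \<psi> n x \<partial>\<mu>) / real n) \<longlonglongrightarrow> (\<integral>x. C x \<partial>\<mu>)"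
    proof (rule tendsto_integral_averages[OF conjunct1[OF \<psi>] diam _ \<mu>])
      show "(\<lambda>n. \<psi> n x / real n) \<longlonglongrightarrow> C x" for x
        using tendsto_diff[OF lim[of x] null_seqs_pointwise[OF conjunct2[OF \<psi>], of x]]
        by (simp add: diff_divide_distrib)
    qed
  qed
  then show "c = (\<integral>x. C x \<partial>\<mu>)"
    if "\<forall>\<psi>\<in>\<eta>. (\<lambda>n. (\<integral>x. \<psi> n x \<partial>\<mu>) / real n) \<longlonglongrightarrow> c" for c
    using that \<open>\<phi> \<in> \<eta>\<close> by (blast intro: LIMSEQ_unique)
qed

section \<open>Equidistribution on a periodic orbit\<close>

definition orbit_measure :: "('a::metric_space \<Rightarrow> 'a) \<Rightarrow> nat \<Rightarrow> 'a \<Rightarrow> 'a measure" where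
  "orbit_measure T p x = distr (measure_pmf (pmf_of_set {..<p})) borel (\<lambda>j. (T ^^ j) x)"

lemma prob_space_orbit_measure: "prob_space (orbit_measure T p x)"
  unfolding orbit_measure_def by (rule measure_pmf.prob_space_distr) simp

lemma sets_orbit_measure: "sets (orbit_measure T p x) = sets borel"
  by (simp add: orbit_measure_def)

lemma emeasure_orbit_measure:
  "A \<in> sets borel \<Longrightarrow>
    emeasure (orbit_measure T p x) A = emeasure (measure_pmf (pmf_of_set {..<p})) {j. (T ^^ j) x \<in> A}"
  by (simp add: orbit_measure_def emeasure_distr vimage_def)

lemma bij_betw_Suc_mod: "bij_betw (\<lambda>j. Suc j mod p) {..<p} {..<p}"
proof (cases "p = 0")
  case False
  have "inj_on (\<lambda>j. Suc j mod p) {..<p}"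
    by (rule inj_onI) (auto simp: mod_Suc split: if_splits)
  moreover have "(\<lambda>j. Suc j mod p) ` {..<p} \<subseteq> {..<p}" using False by auto
  ultimately show ?thesis by (simp add: bij_betw_def endo_inj_surj)
qed (simp add: bij_betw_def)

text \<open>On the orbit, \<open>T\<close> acts as the cyclic shift of the index, and the uniform
  distribution on \<open>{..<p}\<close> is invariant under that bijection. Here \<open>p\<close> may
  be any multiple of the least period, since points are counted with multiplicity.\<close>

lemma orbit_measure_invariant:
  fixes T :: "'a::metric_space \<Rightarrow> 'a"
  assumes T: "T \<in> borel_measurable borel" and per: "(T ^^ p) x = x" and p: "p > 0"
  shows "orbit_measure T p x \<in> inv_measures T"
proof -
  let ?P = "pmf_of_set {..<p}"
  have nonempty: "{..<p} \<noteq> {}" using p by auto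
  \<comment> \<open>Periodicity enters at the wrap-around \<open>Suc j = p\<close>.\<close>
  have shift: "(T ^^ (Suc j mod p)) x = T ((T ^^ j) x)" if "j < p" for j
    using that per by (cases "Suc j = p") (auto simp: mod_Suc)
  have "emeasure (orbit_measure T p x) (T -` A) = emeasure (orbit_measure T p x) A"
    if A: "A \<in> sets borel" for A
  proof -
    have "map_pmf (\<lambda>j. Suc j mod p) ?P = ?P"
      using bij_betw_Suc_mod nonempty by (rule map_pmf_of_set_bij_betw) simp
    then have "emeasure (orbit_measure T p x) A
        = emeasure (measure_pmf (map_pmf (\<lambda>j. Suc j mod p) ?P)) {j. (T ^^ j) x \<in> A}"
      using A by (simp add: emeasure_orbit_measure)
    also have "\<dots> = emeasure ?P {j. (T ^^ (Suc j mod p)) x \<in> A}"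
      by (simp add: emeasure_map_pmf vimage_def)
    \<comment> \<open>The two sets of indices need to agree only on the support of
      \<open>?P\<close>, where \<open>shift\<close> applies.\<close>
    also have "\<dots> = emeasure ?P {j. T ((T ^^ j) x) \<in> A}"
      by (rule emeasure_eq_AE)
        (use nonempty shift in \<open>auto simp: AE_measure_pmf_iff\<close>)
    also have "\<dots> = emeasure (orbit_measure T p x) (T -` A)"
      using measurable_sets[OF T A] by (simp add: emeasure_orbit_measure)
    finally show ?thesis by simp
  qed
  then show ?thesis
    by (simp add: inv_measures_def prob_space_orbit_measure sets_orbit_measure)
qed

lemma integral_orbit_measure_const:
  assumes "C \<in> borel_measurable borel" and "\<And>j. C ((T ^^ j) x) = (c::real)"
  shows "(\<integral>y. C y \<partial>orbit_measure T p x) = c"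
  unfolding orbit_measure_def using assms
  by (subst integral_distr) simp_all

lemma orbit_measure_null_outside:
  assumes "Z \<in> sets borel" and "\<And>j. (T ^^ j) x \<in> Z"
  shows "emeasure (orbit_measure T p x) (- Z) = 0"
proof -
  have "{j. (T ^^ j) x \<in> - Z} = {}" using assms(2) by auto
  with assms(1) show ?thesis by (simp add: emeasure_orbit_measure)
qed

text \<open>\<open>C\<close> is constant on the orbit of \<open>z\<close>, so the orbit measure
  evaluates to \<open>C z\<close>; any other invariant measure averages values that are at most
  \<open>C z\<close>.\<close>

lemma max_measures_orbit_measure:
  fixes T :: "'a::metric_space \<Rightarrow> 'a"
  assumes \<phi>: "\<phi> \<in> AA_orb T" "\<phi> \<in> \<eta>"
    and \<eta>: "\<And>\<psi>. \<psi> \<in> \<eta> \<Longrightarrow> \<psi> \<in> AA_orb T \<and> (\<lambda>n x. \<phi> n x - \<psi> n x) \<in> null_seqs T"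
    and T: "T \<in> borel_measurable borel"
    and diam: "\<And>x y :: 'a. dist x y \<le> d"
    and lim: "\<And>x. (\<lambda>n. \<phi> n x / real n) \<longlonglongrightarrow> C x"
    and z: "(T ^^ p) z = z" "p > 0" "\<And>x. C x \<le> C z"
  shows "orbit_measure T p z \<in> max_measures T \<eta>"
proof -
  let ?\<mu> = "orbit_measure T p z"
  have eval: "eval_class \<eta> \<mu> = (\<integral>x. C x \<partial>\<mu>)" if "prob_space \<mu>" "sets \<mu> = sets borel" for \<mu>
    by (rule eval_class_eq_integral[OF \<phi>(2) \<eta> diam lim that])
  note int = tendsto_integral_averages(1)[OF \<phi>(1) diam lim]
  \<comment> \<open>Integrability against one Borel probability measure already contains Borel
    measurability; an orbit measure serves as that instance.\<close>
  have C_meas: "C \<in> borel_measurable borel"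
    using borel_measurable_integrable[OF int[OF prob_space_orbit_measure sets_orbit_measure]]
    by (simp add: measurable_cong_sets[OF sets_orbit_measure refl])
  have "C ((T ^^ j) z) = C z" for j
    using limit_average_orbit[of T \<phi> z "C z" j] \<phi>(1) lim LIMSEQ_unique[OF lim]
    by (auto simp: AA_orb_def)
  with C_meas have "eval_class \<eta> ?\<mu> = C z"
    by (simp add: eval prob_space_orbit_measure sets_orbit_measure integral_orbit_measure_const)
  moreover have "eval_class \<eta> \<nu> \<le> C z" if "\<nu> \<in> inv_measures T" for \<nu>
  proof -
    from that have \<nu>: "prob_space \<nu>" "sets \<nu> = sets borel" by (auto simp: inv_measures_def)
    have "(\<integral>x. C x \<partial>\<nu>) \<le> C z"
      by (rule prob_space.integral_le_const[OF \<nu>(1) int[OF \<nu>]]) (use z in simp)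
    with eval[OF \<nu>] show ?thesis by simp
  qed
  ultimately show ?thesis
    using orbit_measure_invariant[OF T z(1,2)] by (simp add: max_measures_def)
qed

section \<open>The system of contracted cycles\<close>

lemma Rep_cyc: "1 \<le> m \<Longrightarrow> j < period m \<Longrightarrow> Rep_Y_space (cyc m j) = Some (m, j)"
  by (simp add: cyc_def Abs_Y_space_inverse)

lemma Rep_star: "Rep_Y_space star = None"
  by (simp add: star_def Abs_Y_space_inverse)

lemma Y_space_cases:
  obtains "u = star" | m j where "1 \<le> m" "j < period m" "u = cyc m j"
  using Rep_Y_space[of u] Rep_Y_space_inverse[of u] that
  by (auto simp: star_def cyc_def)

lemma radius_star: "radius star = 0"
  by (simp add: radius_eq_0_iff)

lemma radius_cyc: "1 \<le> m \<Longrightarrow> j < period m \<Longrightarrow> radius (cyc m j) = rad m"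
  by (simp add: radius_def Rep_cyc)

lemma rotate_star: "rotate_cycles star = star"
  by (simp add: rotate_cycles_def Rep_star)

lemma rotate_cyc:
  "1 \<le> m \<Longrightarrow> j < period m \<Longrightarrow> rotate_cycles (cyc m j) = cyc m (Suc j mod period m)"
  by (simp add: rotate_cycles_def Rep_cyc)

lemma period_pos: "period m > 0"
  by (simp add: period_def)

lemma rotate_funpow_star: "(rotate_cycles ^^ n) star = star"
  by (induction n) (simp_all add: rotate_star)

lemma rotate_funpow_cyc:
  "1 \<le> m \<Longrightarrow> j < period m \<Longrightarrow> (rotate_cycles ^^ n) (cyc m j) = cyc m ((j + n) mod period m)"
  by (induction n) (simp_all add: rotate_cyc period_pos mod_Suc_eq)

lemma rotate_periodic: "\<exists>p>0. (rotate_cycles ^^ p) u = u"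
proof (cases u rule: Y_space_cases)
  case 1
  then show ?thesis by (auto simp: rotate_funpow_star)
next
  case (2 m j)
  then show ?thesis by (intro exI[of _ "period m"]) (simp add: rotate_funpow_cyc period_pos)
qed

lemma radius_rotate: "radius (rotate_cycles u) = radius u"
  by (cases u rule: Y_space_cases)
    (simp_all add: rotate_star rotate_cyc radius_cyc period_pos)

lemma radius_rotate_funpow: "radius ((rotate_cycles ^^ n) u) = radius u"
  by (induction n) (simp_all add: radius_rotate)

lemma radius_le_1: "radius u \<le> 1"
  by (cases u rule: Y_space_cases) (simp_all add: radius_star radius_cyc rad_def)

lemma dist_rotate_le: "dist (rotate_cycles u) (rotate_cycles v) \<le> dist u v"
  using radius_nonneg[of u] radius_nonneg[of v] by (auto simp: dist_Y_space_def radius_rotate)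

text \<open>The radii \<open>2^-m\<close> fall below \<open>e\<close> past some \<open>N\<close>,
  and each cycle is finite.\<close>

lemma finite_radius_ge:
  assumes "e > 0"
  shows "finite {u. radius u \<ge> e}"
proof -
  obtain N where N: "(1 / 2 :: real) ^ N < e"
    using real_arch_pow_inv[OF assms, of "1 / 2"] by auto
  \<comment> \<open>The cover also contains \<open>m = 0\<close>, where \<open>cyc\<close> has an
    unspecified value; this is harmless for an upper bound.\<close>
  have "{u. radius u \<ge> e} \<subseteq> case_prod cyc ` (SIGMA m:{..N}. {..<period m})"
  proof
    fix u assume "u \<in> {u. radius u \<ge> e}"
    then have u: "radius u \<ge> e" by simp
    show "u \<in> case_prod cyc ` (SIGMA m:{..N}. {..<period m})"
    proof (cases u rule: Y_space_cases)
      case 1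
      with u assms show ?thesis by (simp add: radius_star)
    next
      case (2 m j)
      have "m \<le> N"
      proof (rule ccontr)
        assume "\<not> m \<le> N"
        then have "(1 / 2 :: real) ^ m \<le> (1 / 2) ^ N" by (intro power_decreasing) auto
        with u 2 N show False by (simp add: radius_cyc rad_def power_one_over)
      qed
      with 2 show ?thesis by force
    qed
  qed
  then show ?thesis by (rule finite_subset) auto
qed

text \<open>If some \<open>w\<close> beats \<open>star\<close>, every point at least as good as
  \<open>w\<close> has radius at least \<open>(f w - f star) / L > 0\<close>. There are finitely
  many of these, and the best of them also beats all other points, whose values lie below
  \<open>f w\<close>.\<close>

lemma attains_max_radius:
  fixes f :: "Y_space \<Rightarrow> real"
  assumes L: "L \<ge> 0" and f: "\<And>u. \<bar>f u - f star\<bar> \<le> L * radius u"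
  obtains u where "\<And>v. f v \<le> f u"
proof (cases "\<forall>v. f v \<le> f star")
  case False
  then obtain w where w: "f w > f star" by (auto simp: not_le)
  let ?S = "{u. f u \<ge> f w}"
  \<comment> \<open>With \<open>L = 0\<close> the function would be constant, contradicting the
    choice of \<open>w\<close>.\<close>
  have "L > 0" using f[of w] w L by (cases "L = 0") auto
  have "?S \<subseteq> {u. radius u \<ge> (f w - f star) / L}"
  proof
    fix u assume "u \<in> ?S"
    with f[of u] have "f w - f star \<le> L * radius u" by simp
    with \<open>L > 0\<close> show "u \<in> {u. radius u \<ge> (f w - f star) / L}"
      by (simp add: pos_divide_le_eq mult.commute)
  qed
  then have "finite ?S"
    by (rule finite_subset) (use w \<open>L > 0\<close> in \<open>simp add: finite_radius_ge\<close>)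
  moreover have "w \<in> ?S" by simp
  ultimately have "Max (f ` ?S) \<in> f ` ?S" by (intro Max_in) auto
  then obtain u where u: "u \<in> ?S" "f u = Max (f ` ?S)" by auto
  have "f v \<le> f u" for v
  proof (cases "v \<in> ?S")
    case True
    with \<open>finite ?S\<close> u(2) show ?thesis by simp
  qed (use u(1) in auto)
  then show ?thesis by (rule that)
qed (use that in blast)

section \<open>The contracting system over the cycles\<close>

definition bottom :: "Y_space \<Rightarrow> X_space" where
  "bottom u = Abs_X_space (u, 0)"

lemma base_bottom [simp]: "base (bottom u) = u" and height_bottom [simp]: "height (bottom u) = 0"
  by (simp_all add: bottom_def base_def height_def Abs_X_space_inverse)

lemma height_bounds: "0 \<le> height x" "height x \<le> 1"
  using Rep_X_space[of x] by (auto simp: height_def mem_Times_iff)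

lemma X_space_eqI: "base x = base y \<Longrightarrow> height x = height y \<Longrightarrow> x = y"
  by (simp add: base_def height_def Rep_X_space_inject[symmetric] prod_eq_iff)

text \<open>Two radii and one height difference, each at most 1.\<close>

lemma dist_X_le: "dist x y \<le> (3::real)" for x y :: X_space
  using radius_le_1[of "base x"] radius_le_1[of "base y"] height_bounds[of x] height_bounds[of y]
  by (auto simp: dist_X_space_def dist_Y_space_def abs_if)

lemma Z_set_alt: "Z_set m = bottom ` Q_set m"
  by (auto simp: Z_set_def image_iff intro!: bexI X_space_eqI)

lemma closed_Z_set: "closed (Z_set m)"
  by (auto simp: Z_set_alt Q_set_def intro!: finite_imp_closed)

lemma bottom_in_Z_set: "\<exists>m. bottom u \<in> Z_set m"
proof (cases u rule: Y_space_cases)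
  case 1
  then show ?thesis by (intro exI[of _ 0]) (simp add: Z_set_def Q_set_def)
next
  case (2 m j)
  then show ?thesis by (intro exI[of _ m]) (auto simp: Z_set_def Q_set_def)
qed

context
  fixes lam :: real
  assumes lam: "0 < lam" "lam < 1"
begin

lemma base_sys_map: "base (sys_map lam x) = rotate_cycles (base x)"
  and height_sys_map: "height (sys_map lam x) = lam * height x"
proof -
  have "(rotate_cycles (base x), lam * height x) \<in> UNIV \<times> {0..1}"
    using height_bounds[of x] lam by (auto intro!: mult_le_one)
  then show "base (sys_map lam x) = rotate_cycles (base x)"
    "height (sys_map lam x) = lam * height x"
    by (simp_all add: sys_map_def base_def height_def Abs_X_space_inverse)
qed

lemma base_sys_map_funpow: "base ((sys_map lam ^^ n) x) = (rotate_cycles ^^ n) (base x)"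
  by (induction n) (simp_all add: base_sys_map)

lemma height_sys_map_funpow: "height ((sys_map lam ^^ n) x) = lam ^ n * height x"
  by (induction n) (simp_all add: height_sys_map)

text \<open>The map does not increase distances: rotation preserves radii and heights are scaled by
  \<open>lam < 1\<close>.\<close>

lemma borel_measurable_sys_map: "sys_map lam \<in> borel_measurable borel"
proof (rule borel_measurable_continuous_onI)
  have "dist (sys_map lam x) (sys_map lam y) \<le> dist x y" for x y
  proof -
    have "\<bar>lam * height x - lam * height y\<bar> = lam * \<bar>height x - height y\<bar>"
      using lam by (simp add: right_diff_distrib[symmetric] abs_mult)
    also have "\<dots> \<le> \<bar>height x - height y\<bar>"
      using lam by (intro mult_left_le_one_le) auto
    finally show ?thesis using dist_rotate_le[of "base x" "base y"]
      by (simp add: dist_X_space_def base_sys_map height_sys_map)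
  qed
  then show "continuous_on UNIV (sys_map lam)"
    unfolding continuous_on_iff by (meson le_less_trans)
qed

lemma sys_map_Z_set: "sys_map lam ` Z_set m \<subseteq> Z_set m"
  by (auto simp: Z_set_def Q_set_def base_sys_map height_sys_map rotate_star rotate_cyc period_pos)

lemma sys_map_funpow_Z_set: "x \<in> Z_set m \<Longrightarrow> (sys_map lam ^^ n) x \<in> Z_set m"
  using sys_map_Z_set by (induction n) auto

lemma bottom_periodic: "\<exists>p>0. (sys_map lam ^^ p) (bottom u) = bottom u"
  using rotate_periodic[of u]
  by (metis X_space_eqI base_bottom base_sys_map_funpow height_bottom height_sys_map_funpow mult_zero_right)

text \<open>Points of one fibre differ in height only, by at most \<open>lam ^ j\<close> after
  \<open>j\<close> steps. The geometric series bounds the sum independently of \<open>n\<close>, so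
  the whole fibre shares one limit.\<close>

lemma sum_dist_bottom_le:
  "(\<Sum>j<n. dist ((sys_map lam ^^ j) (bottom (base x))) ((sys_map lam ^^ j) x)) \<le> 1 / (1 - lam)"
proof -
  have "(\<Sum>j<n. dist ((sys_map lam ^^ j) (bottom (base x))) ((sys_map lam ^^ j) x))
      \<le> (\<Sum>j<n. lam ^ j)"
    using lam height_bounds[of x]
    by (intro sum_mono)
      (simp add: dist_X_space_def base_sys_map_funpow height_sys_map_funpow abs_mult mult_left_le)
  also have "\<dots> \<le> (\<Sum>j. lam ^ j)"
    using lam by (intro sum_le_suminf summable_geometric) auto
  also have "\<dots> = 1 / (1 - lam)" using lam by (intro suminf_geometric) simp
  finally show ?thesis .
qed

text \<open>\<open>star\<close> is fixed and rotation preserves radii, so each summand is at most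
  \<open>radius u\<close>. Divided by \<open>n\<close>, this becomes the Lipschitz estimate for the
  limits at \<open>star\<close>.\<close>

lemma sum_dist_star_le:
  "(\<Sum>j<n. dist ((sys_map lam ^^ j) (bottom u)) ((sys_map lam ^^ j) (bottom star)))
    \<le> real n * radius u"
proof -
  have "(\<Sum>j<n. dist ((sys_map lam ^^ j) (bottom u)) ((sys_map lam ^^ j) (bottom star)))
      \<le> (\<Sum>j<n. radius u)"
    by (intro sum_mono)
      (simp add: dist_X_space_def base_sys_map_funpow height_sys_map_funpow dist_Y_space_def
        radius_rotate_funpow radius_star radius_nonneg rotate_funpow_star)
  then show ?thesis by simp
qed

lemma maximizing_bottom_point:
  assumes "\<phi> \<in> AA_orb (sys_map lam)"
  obtains C u where "\<And>x. (\<lambda>n. \<phi> n x / real n) \<longlonglongrightarrow> C x" "\<And>x. C x \<le> C (bottom u)"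
proof -
  define f where "f u = lim (\<lambda>n. \<phi> n (bottom u) / real n)" for u
  obtain L where "L \<ge> 0" and
    L: "\<And>n x y. n \<ge> 1 \<Longrightarrow> \<bar>\<phi> n x - \<phi> n y\<bar>
        \<le> L * (\<Sum>j<n. dist ((sys_map lam ^^ j) x) ((sys_map lam ^^ j) y))"
    using assms orbit_lipschitzD[of "sys_map lam" \<phi>] by (auto simp: AA_orb_def)
  have f: "(\<lambda>n. \<phi> n (bottom u) / real n) \<longlonglongrightarrow> f u" for u
  proof -
    obtain p where "p > 0" "(sys_map lam ^^ p) (bottom u) = bottom u"
      using bottom_periodic by blast
    with assms have "convergent (\<lambda>n. \<phi> n (bottom u) / real n)"
      by (intro asymp_additive_periodic_convergent) (auto simp: AA_orb_def)
    then show ?thesis by (simp add: f_def convergent_LIMSEQ_iff)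
  qed
  \<comment> \<open>The limit depends on the base point alone, which reduces the maximization over
    \<open>X_space\<close> to one over \<open>Y_space\<close>.\<close>
  have lim: "(\<lambda>n. \<phi> n x / real n) \<longlonglongrightarrow> f (base x)" for x
  proof (rule tendsto_average_bounded_diff[OF f])
    fix n :: nat assume "n \<ge> 1"
    then show "\<bar>\<phi> n (bottom (base x)) - \<phi> n x\<bar> \<le> L * (1 / (1 - lam))"
      by (intro order_trans[OF L] mult_left_mono sum_dist_bottom_le \<open>L \<ge> 0\<close>) auto
  qed
  have "\<bar>f u - f star\<bar> \<le> L * radius u" for u
  proof (rule LIMSEQ_le_const2)
    show "(\<lambda>n. \<bar>\<phi> n (bottom u) / real n - \<phi> n (bottom star) / real n\<bar>) \<longlonglongrightarrow> \<bar>f u - f star\<bar>"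
      by (intro tendsto_intros f)
    have "\<bar>\<phi> n (bottom u) / real n - \<phi> n (bottom star) / real n\<bar> \<le> L * radius u"
      if "n \<ge> 1" for n
    proof -
      have "\<bar>\<phi> n (bottom u) - \<phi> n (bottom star)\<bar> \<le> L * (real n * radius u)"
        using that by (intro order_trans[OF L] mult_left_mono sum_dist_star_le \<open>L \<ge> 0\<close>) auto
      with that show ?thesis
        by (simp add: diff_divide_distrib[symmetric] pos_divide_le_eq mult_ac)
    qed
    then show "\<exists>N. \<forall>n\<ge>N. \<bar>\<phi> n (bottom u) / real n - \<phi> n (bottom star) / real n\<bar> \<le> L * radius u"
      by blast
  qed
  with \<open>L \<ge> 0\<close> obtain u where "\<And>v. f v \<le> f u" by (rule attains_max_radius) blast
  with lim show ?thesis by (intro that[of "\<lambda>x. f (base x)" u]) simp_all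
qed

lemma E_orb_maximizable_Z_set: "E_orb_maximizable (sys_map lam) (range Z_set)"
proof -
  have "\<exists>m. \<eta> \<in> E_max_on (sys_map lam) (Z_set m)" if \<eta>: "\<eta> \<in> E_orb (sys_map lam)" for \<eta>
  proof -
    from \<eta> obtain \<phi> where \<phi>: "\<phi> \<in> AA_orb (sys_map lam)" "\<phi> \<in> \<eta>"
      "\<And>\<psi>. \<psi> \<in> \<eta> \<Longrightarrow> \<psi> \<in> AA_orb (sys_map lam) \<and> (\<lambda>n x. \<phi> n x - \<psi> n x) \<in> null_seqs (sys_map lam)"
      by (rule E_orb_cases) blast
    from \<phi>(1) obtain C u where lim: "\<And>x. (\<lambda>n. \<phi> n x / real n) \<longlonglongrightarrow> C x"
      and max: "\<And>x. C x \<le> C (bottom u)"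
      by (rule maximizing_bottom_point) blast
    obtain p where p: "(sys_map lam ^^ p) (bottom u) = bottom u" "p > 0"
      using bottom_periodic by blast
    obtain m where m: "bottom u \<in> Z_set m" using bottom_in_Z_set by blast
    let ?\<mu> = "orbit_measure (sys_map lam) p (bottom u)"
    have "?\<mu> \<in> max_measures (sys_map lam) \<eta>"
      by (rule max_measures_orbit_measure[OF \<phi> borel_measurable_sys_map dist_X_le lim p max])
    moreover have "emeasure ?\<mu> (- Z_set m) = 0"
      by (rule orbit_measure_null_outside)
        (use sys_map_funpow_Z_set[OF m] closed_Z_set in auto)
    ultimately show ?thesis
      using \<eta> by (auto simp: E_max_on_def inv_measures_on_def max_measures_def)
  qed
  \<comment> \<open>The reverse inclusion is immediate, as \<open>E_max_on\<close> selects classes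
    from \<open>E_orb\<close>.\<close>
  then have "E_orb (sys_map lam) = (\<Union>Z\<in>range Z_set. E_max_on (sys_map lam) Z)"
    by (auto simp: E_max_on_def)
  then show ?thesis
    using closed_Z_set sys_map_Z_set by (auto simp: E_orb_maximizable_def)
qed

end

theorem theorem5p4:
  fixes lam :: real
  assumes "0 < lam" and "lam < 1"
  shows "countable (range Z_set) \<and> E_orb_maximizable (sys_map lam) (range Z_set)"
  using E_orb_maximizable_Z_set[OF assms] by simp

end
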